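(* Let $t\geq 3$ be an integer. Every subgraph of $C_n^k$ with minimum degree strictly exceeding $\left(2-\frac1{t-2}\right)k+1$ contains $K_t$ as a subgraph. Moreover, this bound is tight in the following sense: whenever $(t-2)\mid k$, $\frac{k}{t-2}\mid n$ and $n>2k+\frac{2k}{t-2}$, there exists a $K_t$-free subgraph of $C_n^k$ with minimum degree $\left(2-\frac1{t-2}\right)k+1$.
   Context: $C_n^k$ is the $k$th power of the cycle $C_n$ on $n$ vertices: two distinct vertices of $C_n$ are adjacent in $C_n^k$ if and only if their distance in $C_n$ is at most $k$. In the tightness statement the subgraph is spanning. *)

theory Defs
  imports "Graph_Theory.Graph_Theory"
begin

text \<open>
  Simple graphs are symmetric loop-free pair digraphs (\<^locale>\<open>pair_graph\<close>): an undirected edge is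
  the pair of its two opposite arcs, so the degree of a vertex is its out-degree.
\<close>

text \<open>The cycle on the vertices 0, ..., n - 1; it is a simple graph only for n at least 3.\<close>

definition cycle_graph :: "nat \<Rightarrow> nat pair_pre_digraph" where
  "cycle_graph n = \<lparr> pverts = {..<n},
     parcs = {(u, v). u < n \<and> v < n \<and> (v = (u + 1) mod n \<or> u = (v + 1) mod n)} \<rparr>"

text \<open>Hop distance: the infimum of the lengths of all walks, hence infinite if there is none.\<close>

definition graph_dist :: "'a pair_pre_digraph \<Rightarrow> 'a \<Rightarrow> 'a \<Rightarrow> ereal" where
  "graph_dist G u v = wf_digraph.\<mu> (with_proj G) (\<lambda>_. 1) u v"

definition graph_power :: "'a pair_pre_digraph \<Rightarrow> nat \<Rightarrow> 'a pair_pre_digraph" where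
  "graph_power G k = \<lparr> pverts = pverts G,
     parcs = {(u, v). u \<in> pverts G \<and> v \<in> pverts G \<and> u \<noteq> v \<and> graph_dist G u v \<le> ereal (real k)} \<rparr>"

text \<open>Only meaningful if the vertex set is finite and nonempty.\<close>

definition min_degree :: "'a pair_pre_digraph \<Rightarrow> nat" where
  "min_degree G = Min (out_degree (with_proj G) ` pverts G)"

definition contains_complete :: "nat \<Rightarrow> 'a pair_pre_digraph \<Rightarrow> bool" where
  "contains_complete t G \<longleftrightarrow>
     (\<exists>K :: 'a pair_pre_digraph. complete_digraph t (with_proj K) \<and> subgraph (with_proj K) (with_proj G))"

lemma pair_graph_cycle_graph:
  assumes "n \<ge> 3"
  shows "pair_graph (cycle_graph n)"
proof -
  have fin: "finite (parcs (cycle_graph n))"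
    by (rule finite_subset[of _ "{..<n} \<times> {..<n}"]) (auto simp: cycle_graph_def)
  have ne: "Suc u mod n = u \<longleftrightarrow> False" "u = Suc u mod n \<longleftrightarrow> False" if "u < n" for u
    using assms that by (cases "Suc u = n"; auto)+
  show ?thesis
    using fin by unfold_locales (auto simp: cycle_graph_def symmetric_def sym_def ne)
qed

end

theory Submission
  imports Defs
begin

text \<open>
  Unroll the cycle: pull \<open>H\<close> back to a graph on the integers along reduction modulo \<open>n\<close>. Each
  vertex \<open>v\<close> then has at most \<open>m = 2k + 1 - \<delta>(H)\<close> non-neighbours in \<open>[v - k, v + k]\<close>, counting
  \<open>v\<close> itself, and with \<open>d = t - 2\<close> the degree hypothesis says \<open>d m < k\<close>. For \<open>r = 1, ..., d\<close>
  there is a clique of \<open>r + 2\<close> vertices inside an interval of length \<open>r m + 1 \<le> k\<close>. For \<open>r = 1\<close>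
  extend a shortest edge \<open>u v\<close>: the positions strictly between \<open>u\<close> and \<open>v\<close> are non-neighbours of
  both, so the two sets of at most \<open>m\<close> non-neighbours cannot cover \<open>[v - m - 1, u + m + 1]\<close>. For
  larger \<open>r\<close> a crude union bound suffices to extend the previous clique by one vertex. Starting the
  induction from a single vertex or an arbitrary edge would lose too much.

  For tightness, put \<open>m = k / d\<close>, cut the cycle into \<open>n / m\<close> blocks of \<open>m\<close> consecutive vertices
  and delete all edges inside blocks. A clique then meets each block at most once, and its blocks
  are pairwise at cyclic distance at most \<open>d\<close> among at least \<open>2 d + 2\<close> blocks. Relative to a
  fixed block of the clique, offsets \<open>e\<close> and \<open>e - d - 1\<close> exclude each other, which leaves at most
  \<open>d\<close> further blocks.
\<close>

section \<open>Short cliques in graphs on the integers\<close>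

definition clique_on :: "('a \<Rightarrow> 'a \<Rightarrow> bool) \<Rightarrow> 'a set \<Rightarrow> bool" where
  "clique_on A S \<longleftrightarrow> (\<forall>u\<in>S. \<forall>v\<in>S. u \<noteq> v \<longrightarrow> A u v)"

definition missed :: "(int \<Rightarrow> int \<Rightarrow> bool) \<Rightarrow> int \<Rightarrow> int \<Rightarrow> int set" where
  "missed A k v = {x \<in> {v - k..v + k}. \<not> A v x}"

lemma finite_missed [simp]: "finite (missed A k v)"
  unfolding missed_def by (rule finite_subset[of _ "{v - k..v + k}"]) auto

text \<open>Every point of \<open>{b - w..a + w}\<close> is within \<open>w\<close> of every point
  of \<open>{a..b}\<close>, so it fails to be a common neighbour only by lying in a missed set.
  These sets have at most \<open>card S * m\<close> elements in all, fewer than the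
  \<open>2 * w + 1 - (b - a)\<close> points available.\<close>

lemma common_neighbour_if_few_missed:
  fixes A :: "int \<Rightarrow> int \<Rightarrow> bool" and k m w a b :: int
  assumes deg: "\<And>v. v \<in> S \<Longrightarrow> int (card (missed A k v)) \<le> m"
    and S: "finite S" "S \<subseteq> {a..b}"
    and w: "b - a \<le> w" "w \<le> k" "int (card S) * m < 2 * w + 1 - (b - a)"
  obtains x where "x \<in> {b - w..a + w}" "\<And>v. v \<in> S \<Longrightarrow> A v x"
proof -
  define N where "N = missed A k"
  have "\<not> {b - w..a + w} \<subseteq> (\<Union>v\<in>S. N v)"
  proof
    assume cover: "{b - w..a + w} \<subseteq> (\<Union>v\<in>S. N v)"
    have "card {b - w..a + w} \<le> card (\<Union>v\<in>S. N v)"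
      using S(1) by (intro card_mono cover) (auto simp: N_def)
    also have "\<dots> \<le> (\<Sum>v\<in>S. card (N v))"
      by (rule card_UN_le[OF S(1)])
    finally have "int (card {b - w..a + w}) \<le> (\<Sum>v\<in>S. int (card (N v)))"
      by (metis of_nat_mono of_nat_sum)
    also have "\<dots> \<le> (\<Sum>v\<in>S. m)"
      using deg by (intro sum_mono) (simp add: N_def)
    finally show False using w by (simp split: if_splits)
  qed
  then obtain x where x: "x \<in> {b - w..a + w}" "\<And>v. v \<in> S \<Longrightarrow> x \<notin> N v" by blast
  have "A v x" if "v \<in> S" for v
  proof -
    have "v \<in> {a..b}" using S(2) that by blast
    then show ?thesis using x(2)[OF that] x(1) w by (auto simp: N_def missed_def)
  qed
  with x(1) that show ?thesis by blast
qed

text \<open>The \<open>m + 1\<close> positions from \<open>v\<close> to \<open>v + m\<close> cannot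
  all be missed, and irreflexivity rules out \<open>v\<close> itself.\<close>

lemma short_edge:
  fixes A :: "int \<Rightarrow> int \<Rightarrow> bool" and k m :: int
  assumes irr: "\<And>v. \<not> A v v"
    and deg: "int (card (missed A k v)) \<le> m"
    and m: "m \<le> k"
  obtains x where "v < x" "x \<le> v + m" "A v x"
proof -
  have "\<not> {v..v + m} \<subseteq> missed A k v"
  proof
    assume "{v..v + m} \<subseteq> missed A k v"
    then have "card {v..v + m} \<le> card (missed A k v)"
      by (intro card_mono) auto
    then show False using deg by simp
  qed
  then obtain x where "x \<in> {v..v + m}" "A v x" using m by (fastforce simp: missed_def)
  then show ?thesis using that irr by (metis atLeastAtMost_iff order_le_less)
qed

lemma short_triangle:
  fixes A :: "int \<Rightarrow> int \<Rightarrow> bool" and k m :: int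
  assumes sym: "\<And>u v. A u v \<Longrightarrow> A v u" and irr: "\<And>v. \<not> A v v"
    and dom: "\<And>u v. A u v \<Longrightarrow> v \<in> V"
    and deg: "\<And>v. v \<in> V \<Longrightarrow> int (card (missed A k v)) \<le> m"
    and V: "V \<noteq> {}" and m: "m + 1 \<le> k"
  obtains u v x where "A u v" "A u x" "A v x" "{u, v, x} \<subseteq> {min u x..min u x + (m + 1)}"
proof -
  define N where "N = missed A k"
  have fin: "finite (N v)" for v by (simp add: N_def)
  \<comment> \<open>Edge lengths are natural numbers, so a shortest edge exists although there are
    infinitely many positions.\<close>
  define P where "P \<delta> \<longleftrightarrow> (\<exists>u v. A u v \<and> v = u + int \<delta> \<and> u < v)" for \<delta>
  have "\<exists>\<delta>. P \<delta>"
  proof -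
    obtain v where "v \<in> V" using V by blast
    have "m \<le> k" using m by simp
    then obtain x where "v < x" "A v x"
      by (rule short_edge[OF irr deg[OF \<open>v \<in> V\<close>]])
    then have "P (nat (x - v))" unfolding P_def by (intro exI[of _ v] exI[of _ x]) auto
    then show ?thesis ..
  qed
  then have "P (LEAST \<delta>. P \<delta>)" by (rule LeastI_ex)
  then obtain u v where uv: "A u v" "v = u + int (LEAST \<delta>. P \<delta>)" "u < v"
    unfolding P_def by blast
  have least: "v - u \<le> y - x" if "A x y" "x < y" for x y
  proof -
    have "P (nat (y - x))" unfolding P_def using that by (intro exI[of _ x] exI[of _ y]) auto
    then have "(LEAST \<delta>. P \<delta>) \<le> nat (y - x)" by (rule Least_le)
    then show ?thesis using uv(2) that by linarith
  qed
  have inV: "u \<in> V" "v \<in> V" using uv(1) sym dom by blast+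
  \<comment> \<open>\<open>short_edge\<close> is used again, now at \<open>u\<close>: a shortest
    edge is no longer than the one found there.\<close>
  have "m \<le> k" using m by simp
  then obtain y where "u < y" "y \<le> u + m" "A u y"
    by (rule short_edge[OF irr deg[OF inV(1)]])
  with least[of u y] have short: "v - u \<le> m" by simp
  define W where "W = {v - (m + 1)..u + (m + 1)}"
  \<comment> \<open>\<open>W\<close> has \<open>2 * m + 3 - (v - u)\<close> points. The two missed
    sets share the \<open>v - u - 1\<close> positions between \<open>u\<close> and \<open>v\<close>,
    so their union has at most \<open>2 * m + 1 - (v - u)\<close>. With radius \<open>m\<close> in
    place of \<open>m + 1\<close> the counts would tie.\<close>
  have "\<not> W \<subseteq> N u \<union> N v"
  proof
    assume cover: "W \<subseteq> N u \<union> N v"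
    have "{u<..<v} \<subseteq> N u \<inter> N v"
    proof
      fix y assume y: "y \<in> {u<..<v}"
      then have "\<not> A u y" "\<not> A y v" using least[of u y] least[of y v] by auto
      with y short m sym show "y \<in> N u \<inter> N v" by (auto simp: N_def missed_def)
    qed
    then have "card {u<..<v} \<le> card (N u \<inter> N v)"
      by (intro card_mono) (auto simp: fin)
    moreover have "card W \<le> card (N u \<union> N v)"
      by (intro card_mono cover) (auto simp: fin)
    moreover have "card (N u) + card (N v) = card (N u \<union> N v) + card (N u \<inter> N v)"
      by (intro card_Un_Int fin)
    moreover have "int (card (N u)) \<le> m" "int (card (N v)) \<le> m"
      using deg inV by (simp_all add: N_def)
    ultimately show False using uv(3) short unfolding W_def by simp
  qed
  then obtain x where x: "x \<in> W" "x \<notin> N u" "x \<notin> N v" by blast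
  have "A u x" "A v x" using x uv(3) short m by (auto simp: N_def W_def missed_def)
  moreover have "{u, v, x} \<subseteq> {min u x..min u x + (m + 1)}"
    using x(1) uv(3) short by (auto simp: W_def)
  ultimately show ?thesis using that uv(1) by blast
qed

text \<open>Induction on \<open>r\<close>, each step adding one vertex and at most \<open>m\<close>
  to the length of the interval; \<open>int r * m + 1 \<le> k\<close> keeps all candidates within
  reach of the clique.\<close>

lemma short_clique:
  fixes A :: "int \<Rightarrow> int \<Rightarrow> bool" and k m :: int
  assumes sym: "\<And>u v. A u v \<Longrightarrow> A v u" and irr: "\<And>v. \<not> A v v"
    and dom: "\<And>u v. A u v \<Longrightarrow> v \<in> V"
    and deg: "\<And>v. v \<in> V \<Longrightarrow> int (card (missed A k v)) \<le> m"
    and V: "V \<noteq> {}" and m: "0 \<le> m" and r: "1 \<le> r" "int r * m + 1 \<le> k"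
  shows "\<exists>S a. finite S \<and> card S = r + 2 \<and> S \<subseteq> V \<and> clique_on A S \<and> S \<subseteq> {a..a + (int r * m + 1)}"
  using r
proof (induction r rule: dec_induct)
  case base
  then have mk: "m + 1 \<le> k" by simp
  obtain u v x where T: "A u v" "A u x" "A v x"
    and sub: "{u, v, x} \<subseteq> {min u x..min u x + (m + 1)}"
    by (rule short_triangle[OF sym irr dom deg V mk])
  have "u \<noteq> v" "u \<noteq> x" "v \<noteq> x" using T irr by blast+
  then have "card {u, v, x} = 1 + 2" by simp
  moreover have "clique_on A {u, v, x}" using T sym by (auto simp: clique_on_def)
  moreover have "{u, v, x} \<subseteq> V" using T sym dom by blast
  ultimately show ?case using sub
    by (intro exI[of _ "{u, v, x}"] exI[of _ "min u x"]) auto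
next
  case (step r)
  define s where "s = int r * m + 1"
  define w where "w = int (Suc r) * m + 1"
  have ws: "w = s + m" by (simp add: w_def s_def algebra_simps)
  have "w \<le> k" using step.prems by (simp add: w_def)
  with ws m step.IH obtain S a where S: "finite S" "card S = r + 2" "S \<subseteq> V" "clique_on A S"
    "S \<subseteq> {a..a + s}"
    unfolding s_def by (metis add.commute add_le_cancel_left dual_order.trans le_add_same_cancel1)
  \<comment> \<open>The candidates run from \<open>a - m\<close> to \<open>a + s + m\<close>. These
    are \<open>s + 2 * m + 1\<close> positions, two more than the clique can miss.\<close>
  have "int (card S) * m = s + 2 * m - 1" using S(2) by (simp add: s_def algebra_simps)
  moreover have s: "0 < s" using m by (simp add: s_def add_nonneg_pos)
  ultimately obtain x where x: "x \<in> {a + s - w..a + w}" "\<And>v. v \<in> S \<Longrightarrow> A v x"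
    using common_neighbour_if_few_missed[where S = S and k = k and A = A and m = m and a = a and b = "a + s" and w = w] deg S(1,3,5) ws m \<open>w \<le> k\<close> by auto
  have "x \<notin> S" using x(2) irr by blast
  then have "card (insert x S) = Suc r + 2" using S(1,2) by simp
  moreover have "clique_on A (insert x S)" using S(4) x(2) sym by (auto simp: clique_on_def)
  moreover have "S \<noteq> {}" using S(2) by auto
  then have "insert x S \<subseteq> V" using S(3) x(2) dom by blast
  moreover have "insert x S \<subseteq> {min a x..min a x + w}" 
    using S(5) x(1) ws m s by (auto simp: min_def)
  ultimately show ?case unfolding w_def using S(1)
    by (intro exI[of _ "insert x S"] exI[of _ "min a x"]) auto
qed

section \<open>Walks and distances in the cycle, and its powers\<close>

lemma cycle_graph_arc_iff:
  "(u, v) \<in> parcs (cycle_graph n) \<longleftrightarrow> u < n \<and> v < n \<and>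
     (int v = (int u + 1) mod int n \<or> int v = (int u - 1) mod int n)"
proof -
  have "u = (v + 1) mod n \<longleftrightarrow> int v = (int u - 1) mod int n" if "u < n" "v < n"
  proof
    assume "u = (v + 1) mod n"
    then have "int u = (int v + 1) mod int n" by (metis of_nat_1 of_nat_add zmod_int)
    then show "int v = (int u - 1) mod int n" using that by (simp add: mod_simps)
  next
    assume v: "int v = (int u - 1) mod int n"
    have "int ((v + 1) mod n) = (int v + 1) mod int n" by (metis of_nat_1 of_nat_add zmod_int)
    also have "\<dots> = int u" unfolding v using that by (simp add: mod_simps)
    finally show "u = (v + 1) mod n" by simp
  qed
  moreover have "v = (u + 1) mod n \<longleftrightarrow> int v = (int u + 1) mod int n"
    by (metis of_nat_1 of_nat_add of_nat_eq_iff zmod_int)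
  ultimately show ?thesis unfolding cycle_graph_def by auto
qed

lemma wf_cycle_graph: "wf_digraph (with_proj (cycle_graph n))"
  by unfold_locales (auto simp: cycle_graph_def)

text \<open>The walk is lifted to the integers: each arc shifts the lift by 1 or -1, and
  \<open>x\<close> is where the lift from \<open>u\<close> ends.\<close>

lemma awalk_cycle_graphD:
  assumes "pre_digraph.awalk (with_proj (cycle_graph n)) u p v"
  shows "\<exists>x. \<bar>x - int u\<bar> \<le> int (length p) \<and> x mod int n = int v"
proof -
  interpret wf_digraph "with_proj (cycle_graph n)" by (rule wf_cycle_graph)
  from assms show ?thesis
  proof (induction p arbitrary: u)
    case Nil
    then have "u = v" "u < n" unfolding awalk_Nil_iff by (auto simp: cycle_graph_def)
    then show ?case by (intro exI[of _ "int u"]) auto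
  next
    case (Cons e p)
    obtain w where e: "e = (u, w)" "(u, w) \<in> parcs (cycle_graph n)" "awalk w p v"
      using Cons.prems by (cases e) (auto simp: awalk_Cons_iff)
    from Cons.IH[OF e(3)] obtain x where x: "\<bar>x - int w\<bar> \<le> int (length p)" "x mod int n = int v"
      by blast
    from e(2) obtain c :: int where c: "\<bar>c\<bar> = 1" "int w = (int u + c) mod int n"
      unfolding cycle_graph_arc_iff by (metis abs_1 abs_minus_cancel diff_conv_add_uminus)
    \<comment> \<open>The lift of the tail starts at \<open>w\<close>. Translating it by this
      multiple of \<open>n\<close> makes it start at \<open>int u + c\<close> and keeps the residue
      of its end.\<close>
    have "(x + (int u + c - int w)) mod int n = int v"
    proof -
      have "int u + c - int w = int n * ((int u + c) div int n)"
        unfolding c(2) by (rule minus_mod_eq_mult_div)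
      then show ?thesis using x(2) by simp
    qed
    then show ?case using x(1) c(1) by (intro exI[of _ "x + (int u + c - int w)"]) auto
  qed
qed

text \<open>Going straight from \<open>u\<close> to \<open>x\<close>, one unit at a time, and
  reducing modulo \<open>n\<close> traces a walk.\<close>

lemma awalk_cycle_graphI:
  assumes "u < n"
  shows "\<exists>p. pre_digraph.awalk (with_proj (cycle_graph n)) u p (nat (x mod int n)) \<and>
           int (length p) = \<bar>x - int u\<bar>"
proof -
  interpret wf_digraph "with_proj (cycle_graph n)" by (rule wf_cycle_graph)
  show ?thesis
    using assms
  proof (induction "nat \<bar>x - int u\<bar>" arbitrary: u x)
    case 0
    then have "awalk u [] (nat (x mod int n))"
      unfolding awalk_Nil_iff by (auto simp: cycle_graph_def)
    with 0 show ?case by (intro exI[of _ "[]"]) auto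
  next
    case (Suc l)
    define c where "c = sgn (x - int u)"
    have c: "c = 1 \<or> c = - 1" "\<bar>x - (int u + c)\<bar> = int l" using Suc.hyps(2)
      by (auto simp: c_def sgn_if)
    define w where "w = nat ((int u + c) mod int n)"
    have w: "int w = (int u + c) mod int n" "w < n"
      using Suc.prems by (auto simp: w_def nat_less_iff)
    have arc: "(u, w) \<in> parcs (cycle_graph n)"
      using c(1) w Suc.prems by (auto simp: cycle_graph_arc_iff)
    \<comment> \<open>If the first arc wraps around, the target is translated by the same multiple
      of \<open>n\<close>, so that the distance left is still \<open>l\<close>.\<close>
    have "l = nat \<bar>(x + (int w - (int u + c))) - int w\<bar>" using c(2) by simp
    from Suc.hyps(1)[OF this w(2)] obtain p where
      p: "awalk w p (nat ((x + (int w - (int u + c))) mod int n))" "int (length p) = int l"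
      using c(2) by auto
    have "(x + (int w - (int u + c))) mod int n = x mod int n"
    proof -
      have "int w - (int u + c) = int n * - ((int u + c) div int n)"
        unfolding w(1) using minus_mod_eq_mult_div[of "int u + c" "int n"] by simp
      then show ?thesis by (simp only: mod_mult_self2)
    qed
    with p(1) arc have "awalk u ((u, w) # p) (nat (x mod int n))"
      by (simp add: awalk_Cons_iff)
    then show ?case using p(2) Suc.hyps(2) by (intro exI[of _ "(u, w) # p"]) auto
  qed
qed

lemma graph_dist_cycle_graph_le_iff:
  assumes "u < n" "v < n"
  shows "graph_dist (cycle_graph n) u v \<le> ereal (real k) \<longleftrightarrow>
           (\<exists>x \<in> {int u - int k..int u + int k}. x mod int n = int v)"
proof -
  interpret wf_digraph "with_proj (cycle_graph n)" by (rule wf_cycle_graph)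
  have cost: "awalk_cost (\<lambda>_. 1) p = real (length p)" for p :: "(nat \<times> nat) list"
    by (induction p) auto
  show ?thesis
  proof
    assume le: "graph_dist (cycle_graph n) u v \<le> ereal (real k)"
    have "\<exists>p. awalk u p v \<and> length p \<le> k"
    proof (rule ccontr)
      assume "\<nexists>p. awalk u p v \<and> length p \<le> k"
      \<comment> \<open>Lengths are integers, so if all walks are longer than \<open>k\<close>,
        their infimum is at least \<open>k + 1\<close>; this also covers the infinite infimum over
        no walks.\<close>
      then have "ereal (real (k + 1)) \<le> graph_dist (cycle_graph n) u v"
        unfolding graph_dist_def \<mu>_def by (intro INF_greatest) (force simp: cost)
      with le have "ereal (real (k + 1)) \<le> ereal (real k)" by (rule order_trans[rotated])
      then show False by simp
    qed
    then obtain p where "awalk u p v" "length p \<le> k" by blast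
    with awalk_cycle_graphD[of n u p v] show "\<exists>x \<in> {int u - int k..int u + int k}. x mod int n = int v"
      by (force simp: abs_le_iff)
  next
    assume "\<exists>x \<in> {int u - int k..int u + int k}. x mod int n = int v"
    then obtain x where x: "\<bar>x - int u\<bar> \<le> int k" "x mod int n = int v"
      by (force simp: abs_le_iff)
    from awalk_cycle_graphI[OF assms(1), of x] obtain p
      where p: "awalk u p v" "int (length p) = \<bar>x - int u\<bar>" using x(2) by auto
    have "graph_dist (cycle_graph n) u v \<le> ereal (awalk_cost (\<lambda>_. 1) p)"
      unfolding graph_dist_def by (rule min_cost_le_walk_cost[OF p(1)])
    also have "\<dots> \<le> ereal (real k)" using p(2) x(1) by (simp add: cost)
    finally show "graph_dist (cycle_graph n) u v \<le> ereal (real k)" .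
  qed
qed

lemma pverts_graph_power_cycle [simp]: "pverts (graph_power (cycle_graph n) k) = {..<n}"
  by (simp add: graph_power_def cycle_graph_def)

lemma graph_power_cycle_arc_iff:
  "(u, v) \<in> parcs (graph_power (cycle_graph n) k) \<longleftrightarrow> u < n \<and> v < n \<and> u \<noteq> v \<and>
     (\<exists>x \<in> {int u - int k..int u + int k}. x mod int n = int v)"
  using graph_dist_cycle_graph_le_iff[of u n v k]
  by (auto simp: graph_power_def cycle_graph_def)


lemma wf_graph_power_cycle: "wf_digraph (with_proj (graph_power (cycle_graph n) k))"
  by unfold_locales (auto simp: graph_power_def)

lemma graph_power_cycle_arc_sym:
  assumes "(u, v) \<in> parcs (graph_power (cycle_graph n) k)"
  shows "(v, u) \<in> parcs (graph_power (cycle_graph n) k)"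
proof -
  from assms obtain x where x: "u < n" "v < n" "u \<noteq> v"
    "x \<in> {int u - int k..int u + int k}" "x mod int n = int v"
    unfolding graph_power_cycle_arc_iff by blast
  \<comment> \<open>Translating \<open>int u\<close> and \<open>x\<close> by the multiple
    \<open>int v - x\<close> of \<open>n\<close> turns \<open>x\<close> into \<open>int v\<close>
    and gives a lift of \<open>u\<close> within \<open>k\<close> of it.\<close>
  have "int v - x = int n * - (x div int n)"
    using minus_mod_eq_mult_div[of x "int n"] x(5) by simp
  then have "(int u + (int v - x)) mod int n = int u mod int n"
    by (simp only: mod_mult_self2)
  then have "(int u + (int v - x)) mod int n = int u" using x(1) by simp
  moreover have "int u + (int v - x) \<in> {int v - int k..int v + int k}" using x(4) by auto
  ultimately show ?thesis using x(1-3) unfolding graph_power_cycle_arc_iff by blast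
qed

section \<open>Complete subgraphs from large minimum degree\<close>

lemma contains_complete_iff:
  assumes "pair_graph H"
  shows "contains_complete t H \<longleftrightarrow>
    (\<exists>S. S \<subseteq> pverts H \<and> card S = t \<and> clique_on (\<lambda>u v. (u, v) \<in> parcs H) S)"
proof
  assume "contains_complete t H"
  then obtain K :: "'a pair_pre_digraph" where
    K: "complete_digraph t (with_proj K)" "subgraph (with_proj K) (with_proj H)"
    unfolding contains_complete_def by blast
  then show "\<exists>S. S \<subseteq> pverts H \<and> card S = t \<and> clique_on (\<lambda>u v. (u, v) \<in> parcs H) S"
    by (intro exI[of _ "pverts K"])
      (auto simp: complete_digraph_pair_def subgraph_def clique_on_def)
next
  interpret pair_graph H by fact
  assume "\<exists>S. S \<subseteq> pverts H \<and> card S = t \<and> clique_on (\<lambda>u v. (u, v) \<in> parcs H) S"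
  then obtain S where S: "S \<subseteq> pverts H" "card S = t" "clique_on (\<lambda>u v. (u, v) \<in> parcs H) S"
    by blast
  define K where "K = \<lparr>pverts = S, parcs = {(u, v). (u, v) \<in> S \<times> S \<and> u \<noteq> v}\<rparr>"
  have "finite S" using S(1) pair_finite_verts by (rule finite_subset)
  then have "complete_digraph t (with_proj K)"
    using S(2) by (simp add: complete_digraph_pair_def K_def)
  moreover have "subgraph (with_proj K) (with_proj H)"
    using S(1,3) wf_digraph unfolding subgraph_def wf_digraph_wp_iff
    by (auto simp: K_def clique_on_def compatible_def pair_wf_digraph_def)
  ultimately show "contains_complete t H" unfolding contains_complete_def by blast
qed

lemma out_degree_with_proj:
  "out_degree (with_proj G) u = card {v. (u, v) \<in> parcs G}"
proof -
  have "out_arcs (with_proj G) u = Pair u ` {v. (u, v) \<in> parcs G}"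
    by (auto simp: out_arcs_def)
  then show ?thesis by (simp add: out_degree_def card_image inj_on_def)
qed

lemma contains_complete_if_dense:
  assumes t: "t \<ge> 3" and n: "n > 0" and H: "pair_graph H" "pverts H \<noteq> {}"
    and sub: "subgraph (with_proj H) (with_proj (graph_power (cycle_graph n) k))"
    and dense: "real (min_degree H) > (2 - 1 / (real t - 2)) * real k + 1"
  shows "contains_complete t H"
proof -
  interpret pair_graph H by fact
  define f where "f x = nat (x mod int n)" for x
  have f: "int (f x) = x mod int n" "f x < n" for x
    using n by (simp_all add: f_def nat_less_iff)
  define A where "A x y \<longleftrightarrow> (f x, f y) \<in> parcs H" for x y
  define V where "V = {x. f x \<in> pverts H}"
  define m where "m = 2 * int k + 1 - int (min_degree H)"
  define d where "d = t - 2"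
  have d: "1 \<le> d" "real t - 2 = real d" "t = d + 2" using t by (auto simp: d_def)
  have pv: "pverts H \<subseteq> {..<n}" and pa: "parcs H \<subseteq> parcs (graph_power (cycle_graph n) k)"
    using sub by (auto simp: subgraph_def)
  have sym: "A y x" if "A x y" for x y
    using that pair_sym_arcs by (auto simp: A_def symmetric_def dest: symD)
  have irr: "\<not> A x x" for x
    using pair_no_loops by (fastforce simp: A_def)
  have dom: "y \<in> V" if "A x y" for x y
    using that in_arcsD2 by (auto simp: A_def V_def)
  have deg: "int (card (missed A k v)) \<le> m" if "v \<in> V" for v
  proof -
    define W where "W = {v - int k..v + int k}"
    have fin: "finite {x \<in> W. A v x}" by (rule finite_subset[of _ W]) (auto simp: W_def)
    \<comment> \<open>Every neighbour of \<open>f v\<close> has a lift in \<open>W\<close>.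
      Positions in \<open>W\<close> may share a residue when \<open>n \<le> 2 * k\<close>, but a
      surjection already bounds the degree by the number of \<open>A\<close>-neighbours in
      \<open>W\<close>.\<close>
    have "{w. (f v, w) \<in> parcs H} \<subseteq> f ` {x \<in> W. A v x}"
    proof
      fix w assume "w \<in> {w. (f v, w) \<in> parcs H}"
      then have arc: "(f v, w) \<in> parcs H" by simp
      then have "(f v, w) \<in> parcs (graph_power (cycle_graph n) k)" using pa by blast
      then obtain x where x: "x \<in> {int (f v) - int k..int (f v) + int k}" "x mod int n = int w"
        unfolding graph_power_cycle_arc_iff by blast
      define y where "y = x + (v - int (f v))"
      have "v - int (f v) = int n * (v div int n)"
        unfolding f(1) by (rule minus_mod_eq_mult_div)
      then have "f y = w" using x(2) by (simp add: f_def y_def)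
      moreover have "y \<in> W" using x(1) by (auto simp: y_def W_def)
      ultimately show "w \<in> f ` {x \<in> W. A v x}" using arc by (auto simp: A_def)
    qed
    then have "card {w. (f v, w) \<in> parcs H} \<le> card {x \<in> W. A v x}"
      by (rule surj_card_le[OF fin])
    moreover have "min_degree H \<le> out_degree (with_proj H) (f v)"
      using that pair_finite_verts unfolding min_degree_def V_def by (intro Min_le) auto
    moreover have "card W = card {x \<in> W. A v x} + card (missed A k v)"
    proof -
      have "W = {x \<in> W. A v x} \<union> missed A k v" by (auto simp: W_def missed_def)
      moreover have "{x \<in> W. A v x} \<inter> missed A k v = {}" by (auto simp: missed_def)
      ultimately show ?thesis using fin by (metis card_Un_disjoint finite_missed)
    qed
    moreover have "card W = 2 * k + 1" by (simp add: W_def)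
    ultimately show ?thesis by (simp add: m_def out_degree_with_proj)
  qed
  have V: "V \<noteq> {}"
  proof -
    obtain u where "u \<in> pverts H" using H(2) by blast
    then have "int u \<in> V" using pv by (auto simp: V_def f_def)
    then show ?thesis by blast
  qed
  then have m0: "0 \<le> m" using deg by force
  have "real_of_int m < real k / real d"
    using dense unfolding d(2) m_def by (simp add: algebra_simps)
  then have "real_of_int (int d * m) < real_of_int (int k)"
    using d(1) by (simp add: field_simps)
  then have "int d * m < int k" by (simp only: of_int_less_iff)
  \<comment> \<open>Integrality makes room for the extra 1 in the interval length of
    \<open>short_clique\<close>.\<close>
  then have dk: "int d * m + 1 \<le> int k" by simp
  have "\<exists>S a. finite S \<and> card S = d + 2 \<and> S \<subseteq> V \<and> clique_on A S \<and> S \<subseteq> {a..a + (int d * m + 1)}"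
    by (rule short_clique[where k = "int k"]) (fact sym irr dom deg V m0 d(1) dk)+
  then obtain S where S: "card S = d + 2" "S \<subseteq> V" "clique_on A S" by blast
  \<comment> \<open>Two points of the clique with the same image would give a loop in
    \<open>H\<close>.\<close>
  have "inj_on f S"
    using S(3) irr by (force simp: inj_on_def clique_on_def A_def)
  then have "card (f ` S) = t" using S(1) d(3) by (simp add: card_image)
  moreover have "f ` S \<subseteq> pverts H" using S(2) by (auto simp: V_def)
  moreover have "clique_on (\<lambda>u v. (u, v) \<in> parcs H) (f ` S)"
    using S(3) by (auto simp: clique_on_def A_def)
  ultimately show ?thesis using contains_complete_iff[OF H(1)] by blast
qed

section \<open>The extremal block construction\<close>

lemma card_circular_clique_le:
  fixes T :: "int set" and q :: int
  assumes T: "finite T" "T \<subseteq> {0..<q}" and q: "2 * int d + 2 \<le> q"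
    and close: "\<And>a b. a \<in> T \<Longrightarrow> b \<in> T \<Longrightarrow> a \<noteq> b \<Longrightarrow> \<exists>e. \<bar>e\<bar> \<le> int d \<and> (a + e) mod q = b"
  shows "card T \<le> d + 1"
proof (cases "T = {}")
  case False
  then obtain a where a: "a \<in> T" by blast
  then have "\<forall>b\<in>T - {a}. \<exists>e. \<bar>e\<bar> \<le> int d \<and> (a + e) mod q = b" using close by blast
  then obtain E where E: "\<And>b. b \<in> T - {a} \<Longrightarrow> \<bar>E b\<bar> \<le> int d \<and> (a + E b) mod q = b"
    by metis
  have E0: "E b \<noteq> 0" if "b \<in> T - {a}" for b
    using E[OF that] that a T(2) by auto
  \<comment> \<open>The nonzero offsets from \<open>-d\<close> to \<open>d\<close> are folded onto
    \<open>1..d\<close>, so that \<open>e\<close> and \<open>e - (d + 1)\<close> get the same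
    value.\<close>
  define h where "h b = (if E b > 0 then E b else E b + (int d + 1))" for b
  have "inj_on h (T - {a})"
  proof (rule inj_onI, rule ccontr)
    fix b c assume bc: "b \<in> T - {a}" "c \<in> T - {a}" "h b = h c" "b \<noteq> c"
    have "E b \<noteq> E c" using E bc by metis
    then have diff: "\<bar>E b - E c\<bar> = int d + 1"
      using bc(3) by (auto simp: h_def split: if_splits)
    from bc obtain e where e: "\<bar>e\<bar> \<le> int d" "(b + e) mod q = c" using close by blast
    have "(a + E b + e) mod q = (a + E c) mod q"
      using e(2) E[OF bc(1)] E[OF bc(2)] by (metis mod_add_left_eq)
    \<comment> \<open>\<open>E b - E c\<close> is plus or minus \<open>d + 1\<close> and
      \<open>\<bar>e\<bar> \<le> d\<close>, so this multiple of \<open>q\<close> is nonzero and at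
      most \<open>2 * d + 1\<close> in absolute value, which is below \<open>q\<close>.\<close>
    then have "q dvd E b + e - E c" by (simp add: mod_eq_dvd_iff algebra_simps)
    then have "q \<le> \<bar>E b + e - E c\<bar>" using diff e(1) by (intro zdvd_imp_le) auto
    then show False using diff e(1) q by linarith
  qed
  moreover have "h ` (T - {a}) \<subseteq> {1..int d}"
  proof (rule image_subsetI)
    fix b assume "b \<in> T - {a}"
    from E[OF this] E0[OF this] show "h b \<in> {1..int d}" by (auto simp: h_def)
  qed
  ultimately have "card (T - {a}) \<le> card {1..int d}"
    by (intro card_inj_on_le) auto
  then show ?thesis using a T(1) by simp
qed simp

definition block_graph :: "nat \<Rightarrow> nat \<Rightarrow> nat \<Rightarrow> nat pair_pre_digraph" where
  "block_graph n k m = \<lparr>pverts = {..<n},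
     parcs = {(u, v). (u, v) \<in> parcs (graph_power (cycle_graph n) k) \<and> u div m \<noteq> v div m}\<rparr>"

lemma pair_graph_block_graph: "pair_graph (block_graph n k m)"
proof -
  have "finite (parcs (block_graph n k m))"
    by (rule finite_subset[of _ "{..<n} \<times> {..<n}"])
      (auto simp: block_graph_def graph_power_cycle_arc_iff)
  moreover have "sym (parcs (block_graph n k m))"
    using graph_power_cycle_arc_sym by (auto simp: sym_def block_graph_def)
  ultimately show ?thesis
    by unfold_locales (auto simp: block_graph_def graph_power_cycle_arc_iff symmetric_def)
qed

lemma spanning_block_graph:
  "spanning (with_proj (block_graph n k m)) (with_proj (graph_power (cycle_graph n) k))"
proof -
  interpret pair_graph "block_graph n k m" by (rule pair_graph_block_graph)
  show ?thesis
    using wf_graph_power_cycle wf_digraph unfolding spanning_def subgraph_def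
    by (auto simp: block_graph_def compatible_def)
qed

text \<open>As \<open>2 * k < n\<close>, the window of \<open>2 * k + 1\<close> integers around
  \<open>u\<close> maps injectively to residues. The block of \<open>u\<close> lies in the window
  because \<open>m \<le> k\<close>; deleting it removes \<open>m\<close> residues, \<open>u\<close>
  itself among them.\<close>

lemma out_degree_block_graph:
  assumes m: "0 < m" "m \<le> k" "m dvd n" and u: "u < n" and n: "2 * k < n"
  shows "out_degree (with_proj (block_graph n k m)) u = 2 * k + 1 - m"
proof -
  define g where "g x = nat (x mod int n)" for x
  define W where "W = {int u - int k..int u + int k}"
  define B where "B = {v. v div m = u div m}"
  have B: "B = {m * (u div m)..<m * (u div m) + m}"
  proof (intro equalityI subsetI)
    fix v assume "v \<in> B"
    then have "u div m = v div m" by (simp add: B_def)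
    then show "v \<in> {m * (u div m)..<m * (u div m) + m}"
      using dividend_less_times_div[OF m(1), of v] by simp
  qed (auto simp: B_def intro!: div_nat_eqI)
  have "{v. (u, v) \<in> parcs (block_graph n k m)} = g ` W - B"
    using u by (force simp: block_graph_def graph_power_cycle_arc_iff g_def W_def B_def nat_less_iff)
  moreover have "B \<subseteq> g ` W"
  proof
    fix v assume v: "v \<in> B"
    have "u \<in> B" by (simp add: B_def)
    then have "int v \<in> W"
      using v m(2) unfolding B W_def atLeastLessThan_iff atLeastAtMost_iff by linarith
    \<comment> \<open>Since \<open>m\<close> divides \<open>n\<close>, the block of \<open>u\<close>
      is not cut off at \<open>n\<close>.\<close>
    obtain q where q: "n = m * q" using m(3) by blast
    have "u div m < q" using u unfolding q by (simp add: less_mult_imp_div_less mult.commute)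
    then have "v div m < q" using v by (simp add: B_def)
    then have "v < n" unfolding q using m(1) by (metis div_less_iff_less_mult mult.commute)
    then have "g (int v) = v" by (simp add: g_def)
    with \<open>int v \<in> W\<close> show "v \<in> g ` W" by force
  qed
  moreover have "inj_on g W"
  proof (rule inj_onI)
    fix x y assume xy: "x \<in> W" "y \<in> W" "g x = g y"
    have "x mod int n = y mod int n" using xy(3) u by (simp add: g_def nat_eq_iff)
    then have "int n dvd x - y" by (simp add: mod_eq_dvd_iff)
    moreover have "\<bar>x - y\<bar> < int n" using xy(1,2) n by (auto simp: W_def)
    ultimately show "x = y" using zdvd_imp_le[of "int n" "\<bar>x - y\<bar>"] by force
  qed
  then have "card (g ` W) = 2 * k + 1" by (simp add: card_image W_def)
  ultimately show ?thesis
    by (simp add: out_degree_with_proj card_Diff_subset B)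
qed

text \<open>The block index is injective on a clique and turns closeness in the power into closeness
  on a cycle of \<open>q\<close> blocks, where \<open>card_circular_clique_le\<close>
  applies.\<close>

lemma block_graph_clique_free:
  assumes m: "0 < m" and q: "2 * d + 2 \<le> q"
  shows "\<not> contains_complete (d + 2) (block_graph (m * q) (m * d) m)"
proof
  assume "contains_complete (d + 2) (block_graph (m * q) (m * d) m)"
  then obtain S where S: "S \<subseteq> {..<m * q}" "card S = d + 2"
    and cl: "clique_on (\<lambda>u v. (u, v) \<in> parcs (block_graph (m * q) (m * d) m)) S"
    unfolding contains_complete_iff[OF pair_graph_block_graph] by (auto simp: block_graph_def)
  define b where "b v = int (v div m)" for v :: nat
  have "inj_on b S"
    using cl by (force simp: inj_on_def clique_on_def block_graph_def b_def)
  then have card: "card (b ` S) = d + 2" using S(2) by (simp add: card_image)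
  have "card (b ` S) \<le> d + 1"
  proof (rule card_circular_clique_le)
    show "finite (b ` S)" using card by (metis card.infinite add_2_eq_Suc' nat.distinct(1))
    show "b ` S \<subseteq> {0..<int q}"
      using S(1) by (auto simp: b_def less_mult_imp_div_less mult.commute)
    show "2 * int d + 2 \<le> int q" using q by simp
  next
    fix x y assume "x \<in> b ` S" "y \<in> b ` S" "x \<noteq> y"
    then obtain u v where uv: "u \<in> S" "v \<in> S" "x = b u" "y = b v" "u \<noteq> v" by blast
    then have "(u, v) \<in> parcs (graph_power (cycle_graph (m * q)) (m * d))"
      using cl by (auto simp: clique_on_def block_graph_def)
    then obtain z where z: "int u - int (m * d) \<le> z" "z \<le> int u + int (m * d)"
      "z mod int (m * q) = int v"
      unfolding graph_power_cycle_arc_iff by auto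
    \<comment> \<open>The radius \<open>m * d\<close> is a multiple of \<open>m\<close>, so dividing
      by \<open>m\<close> moves the block index by at most \<open>d\<close>, with no loss from
      rounding.\<close>
    have "z div int m \<le> (int u + int d * int m) div int m"
      using z(2) m by (intro zdiv_mono1) (simp_all add: mult.commute)
    moreover have "(int u + (- int d) * int m) div int m \<le> z div int m"
      using z(1) m by (intro zdiv_mono1) (simp_all add: mult.commute)
    ultimately have "\<bar>z div int m - b u\<bar> \<le> int d"
      using m by (simp only: div_mult_self1) (simp add: b_def zdiv_int)
    \<comment> \<open>Reducing modulo \<open>m * q\<close> and then dividing by \<open>m\<close> is
      the same as dividing by \<open>m\<close> and then reducing modulo \<open>q\<close>.\<close>
    moreover have "(z div int m) mod int q = b v"
    proof -
      have "z mod int (m * q) = int m * (z div int m mod int q) + z mod int m"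
        by (simp add: mod_mult2_eq')
      then have "int v div int m = (int m * (z div int m mod int q) + z mod int m) div int m"
        using z(3) by simp
      also have "\<dots> = z div int m mod int q" using m by simp
      finally show ?thesis by (simp add: b_def zdiv_int)
    qed
    ultimately show "\<exists>e. \<bar>e\<bar> \<le> int d \<and> (x + e) mod int q = y"
      unfolding uv by (intro exI[of _ "z div int m - b u"]) simp
  qed
  with card show False by simp
qed

theorem theorem1p5:
  fixes t :: nat
  assumes "t \<ge> 3"
  shows "(\<forall>n k :: nat. \<forall>H :: nat pair_pre_digraph.
            n \<ge> 3 \<and> pair_graph H \<and> pverts H \<noteq> {} \<and>
            subgraph (with_proj H) (with_proj (graph_power (cycle_graph n) k)) \<and>
            real (min_degree H) > (2 - 1 / (real t - 2)) * real k + 1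
            \<longrightarrow> contains_complete t H) \<and>
         (\<forall>n k :: nat.
            n \<ge> 3 \<and> (t - 2) dvd k \<and> (k div (t - 2)) dvd n \<and>
            real n > 2 * real k + 2 * real k / (real t - 2)
            \<longrightarrow> (\<exists>H :: nat pair_pre_digraph. pair_graph H \<and>
                  spanning (with_proj H) (with_proj (graph_power (cycle_graph n) k)) \<and>
                  \<not> contains_complete t H \<and>
                  real (min_degree H) = (2 - 1 / (real t - 2)) * real k + 1))"
proof (intro conjI allI impI; elim conjE)
  fix n k :: nat and H :: "nat pair_pre_digraph"
  assume "n \<ge> 3" "pair_graph H" "pverts H \<noteq> {}"
    "subgraph (with_proj H) (with_proj (graph_power (cycle_graph n) k))"
    "real (min_degree H) > (2 - 1 / (real t - 2)) * real k + 1"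
  then show "contains_complete t H"
    by (intro contains_complete_if_dense[OF assms, of n H k]) auto
next
  fix n k :: nat
  assume n: "n \<ge> 3" and dvd: "(t - 2) dvd k" "(k div (t - 2)) dvd n"
    and big: "real n > 2 * real k + 2 * real k / (real t - 2)"
  define d where "d = t - 2"
  have d: "1 \<le> d" "real t - 2 = real d" "t = d + 2" using assms by (auto simp: d_def)
  define m where "m = k div d"
  have k: "k = m * d" using dvd(1) by (simp add: m_def d_def)
  obtain q where q: "n = m * q" using dvd(2) unfolding m_def d_def by blast
  \<comment> \<open>\<open>m = 0\<close>, that is \<open>k = 0\<close>, would force
    \<open>n = 0\<close> by divisibility.\<close>
  have m: "0 < m" using q n by (cases m) auto
  \<comment> \<open>With \<open>k = m * d\<close> the bound on \<open>n\<close> reads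
    \<open>m * q > 2 * m * d + 2 * m\<close>: there are more than \<open>2 * d + 2\<close>
    blocks.\<close>
  have "real (2 * d + 2) * real m < real q * real m"
    using big d(1) unfolding d(2) k q by (simp add: algebra_simps)
  then have dq: "2 * d + 2 < q" using m by (simp only: of_nat_less_iff mult_less_cancel_right)
  have mk: "m \<le> k" using k d(1) by simp
  have kn: "2 * k < n"
  proof -
    have "m * (2 * d) < m * q" using dq m by simp
    then show ?thesis unfolding k q by simp
  qed
  define H where "H = block_graph n k m"
  have "m dvd n" by (simp add: q)
  then have "out_degree (with_proj H) u = 2 * k + 1 - m" if "u \<in> pverts H" for u
    using that out_degree_block_graph[OF m mk _ _ kn] by (simp add: H_def block_graph_def)
  moreover have "0 \<in> pverts H" using n by (simp add: H_def block_graph_def)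
  ultimately have "out_degree (with_proj H) ` pverts H = {2 * k + 1 - m}" by force
  then have "real (min_degree H) = real (2 * k + 1 - m)" by (simp add: min_degree_def)
  also have "\<dots> = 2 * real k + 1 - real m" using mk by (simp add: of_nat_diff)
  also have "\<dots> = (2 - 1 / (real t - 2)) * real k + 1"
    using d(1) unfolding d(2) k by (simp add: field_simps)
  finally have "real (min_degree H) = (2 - 1 / (real t - 2)) * real k + 1" .
  moreover have "\<not> contains_complete t H"
    using block_graph_clique_free[OF m, of d q] dq unfolding H_def d(3) k q by simp
  ultimately show "\<exists>H :: nat pair_pre_digraph. pair_graph H \<and>
      spanning (with_proj H) (with_proj (graph_power (cycle_graph n) k)) \<and>
      \<not> contains_complete t H \<and>
      real (min_degree H) = (2 - 1 / (real t - 2)) * real k + 1"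
    using pair_graph_block_graph spanning_block_graph unfolding H_def by blast
qed

end
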